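(* For every integer $p\ge 0$, \[\det[\chi_{i+j}(R)]_{i,j=0}^p=R^p\,\mathsf{sf}(p)\sum_{\sigma\in X_{p-1}}W_0(\sigma,R),\qquad \det[\chi_{i+j+2}(R)]_{i,j=0}^p=R^{p+1}\,\mathsf{sf}(p)\sum_{\sigma\in X_{p+1}}W_2(\sigma,R).\]
   Context: The reverse Bessel polynomials $\chi_i(R)\in\mathbb{Z}[R]$ are defined by $\chi_0=1$, $\chi_1=R$, $\chi_{i+2}=R^2\chi_i+(2i+1)\chi_{i+1}$. The superfactorial is $\mathsf{sf}(k)=\prod_{i=0}^k i!$. A Schröder path is a finite directed path in $\mathbb{Z}^2$ each of whose steps is an ascent $(x,y)\to(x+1,y+1)$, a descent $(x,y)\to(x+1,y-1)$, or a flat step $(x,y)\to(x+2,y)$ (the empty path is allowed). Let $P_i=(-i,i)$ and $Q_i=(i,i)$. For $k\ge 0$, $X_k$ is the set of collections of $k+1$ Schröder paths, pairwise vertex-disjoint, going from $\{P_i\}_{i=0}^k$ to $\{Q_i\}_{i=0}^k$; $X_{-1}$ consists only of the empty collection. The weight $W_0(\sigma,R)$ of a collection is the product over all steps of: $1$ for an ascent, $R$ for a flat step, $y+1$ for a descent starting at height $y$. The weight $W_2(\sigma,R)$ is the same product but with $y-1$ for a descent starting at height $y$. Empty products equal $1$. *)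

theory Defs
  imports "HOL-Computational_Algebra.Polynomial" "Jordan_Normal_Form.Determinant"
begin

abbreviation RR :: "int poly" where "RR \<equiv> [:0, 1:]"

fun chi :: "nat \<Rightarrow> int poly" where
  "chi 0 = 1"
| "chi (Suc 0) = RR"
| "chi (Suc (Suc i)) = RR ^ 2 * chi i + of_nat (2 * i + 1) * chi (Suc i)"

definition sf :: "nat \<Rightarrow> nat" where
  "sf k = (\<Prod>i\<le>k. fact i)"

type_synonym point = "int \<times> int"

definition Pt :: "nat \<Rightarrow> point" where "Pt i = (- int i, int i)"
definition Qt :: "nat \<Rightarrow> point" where "Qt i = (int i, int i)"

definition schroeder_step :: "point \<Rightarrow> point \<Rightarrow> bool" where
  "schroeder_step u v \<longleftrightarrow>
     (fst v = fst u + 1 \<and> snd v = snd u + 1) \<or>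
     (fst v = fst u + 1 \<and> snd v = snd u - 1) \<or>
     (fst v = fst u + 2 \<and> snd v = snd u)"

text \<open>A Schroeder path is given by its nonempty list of vertices
  (a single vertex is the empty path).\<close>
definition schroeder_path :: "point list \<Rightarrow> bool" where
  "schroeder_path xs \<longleftrightarrow> xs \<noteq> [] \<and> successively schroeder_step xs"

text \<open>Collections of n Schroeder paths (n = k+1), indexed by their start
  point P_i, i < n, pairwise vertex-disjoint, whose end points are exactly
  Q_0, ..., Q_(n-1). XX n corresponds to X_(n-1); XX 0 = {empty collection}.\<close>
definition XX :: "nat \<Rightarrow> (nat \<Rightarrow> point list) set" where
  "XX n = {\<sigma>. (\<forall>i<n. schroeder_path (\<sigma> i) \<and> hd (\<sigma> i) = Pt i)
             \<and> (\<lambda>i. last (\<sigma> i)) ` {..<n} = Qt ` {..<n}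
             \<and> (\<forall>i<n. \<forall>j<n. i \<noteq> j \<longrightarrow> set (\<sigma> i) \<inter> set (\<sigma> j) = {})
             \<and> (\<forall>i\<ge>n. \<sigma> i = [])}"

definition step_weight :: "int \<Rightarrow> point \<Rightarrow> point \<Rightarrow> int poly" where
  "step_weight d u v =
     (if fst v = fst u + 2 then RR
      else if snd v = snd u + 1 then 1
      else [: of_int (snd u + d) :])"

definition path_weight :: "int \<Rightarrow> point list \<Rightarrow> int poly" where
  "path_weight d xs = prod_list (map (\<lambda>(u, v). step_weight d u v) (zip xs (tl xs)))"

definition coll_weight :: "int \<Rightarrow> nat \<Rightarrow> (nat \<Rightarrow> point list) \<Rightarrow> int poly" where
  "coll_weight d n \<sigma> = (\<Prod>i<n. path_weight d (\<sigma> i))"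

definition W0 :: "nat \<Rightarrow> (nat \<Rightarrow> point list) \<Rightarrow> int poly" where
  "W0 = coll_weight 1"
definition W2 :: "nat \<Rightarrow> (nat \<Rightarrow> point list) \<Rightarrow> int poly" where
  "W2 = coll_weight (-1)"

end

theory Submission
  imports Defs
begin

text \<open>Let \<open>g n y\<close> count Schroeder paths from height \<open>y\<close> to height \<open>0\<close> with \<open>n\<close> ascents and flat steps,
  a descent from height \<open>y\<close> having weight \<open>y\<close>. Then \<open>\<chi>\<^bsub>n+1\<^esub> = R (g n 0)\<close> and \<open>g 0 y = y!\<close>. The first-step
  recurrence makes \<open>n \<mapsto> g n y\<close> a monic polynomial of degree \<open>y\<close> in the shift operator applied to
  \<open>n \<mapsto> g n 0\<close>, so unitriangular row operations turn the two Hankel determinants into powers of \<open>R\<close>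
  times the determinants of \<open>g j (i + 1)\<close> and \<open>g (j + 1) i\<close>. Row \<open>i\<close> of these matrices counts paths
  from \<open>P\<^sub>i\<close>; a Lindstroem--Gessel--Viennot argument moves the starting points to the \<open>Q\<^sub>i\<close>, where the
  matrix is triangular with factorials on the diagonal, whence the superfactorial.\<close>

subsection \<open>Reverse Bessel polynomials as path counts\<close>

text \<open>\<open>path_count n y\<close> equals \<open>L (s\<^sup>y (s (s + 2R) / 2)\<^sup>n / n!)\<close> for the functional \<open>L (s\<^sup>k) = k!\<close>;
  splitting off one factor \<open>s (s + 2R)\<close> suggests \<open>path_count_Suc_upper\<close>.\<close>
fun path_count :: "nat \<Rightarrow> nat \<Rightarrow> int poly" where
  "path_count 0 0 = 1"
| "path_count 0 (Suc y) = of_nat (Suc y) * path_count 0 y"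
| "path_count (Suc n) 0 = path_count n 1 + RR * path_count n 0"
| "path_count (Suc n) (Suc y) = path_count n (Suc (Suc y)) + RR * path_count n (Suc y) + of_nat (Suc y) * path_count (Suc n) y"

lemma path_count_0: "path_count 0 y = fact y"
  by (induction y) auto

text \<open>Its use is at \<open>y = 0\<close>, where it produces the index-dependent coefficient of
  the three-term recurrence of \<open>chi\<close>.\<close>

lemma path_count_Suc_upper:
  "2 * of_nat (Suc n) * path_count (Suc n) y = path_count n (Suc (Suc y)) + 2 * RR * path_count n (Suc y)"
proof (induction n arbitrary: y)
  case 0
  show ?case
  proof (induction y)
    case 0
    have "2 * (1 + r) = 2 + 2 * r" for r :: "int poly" by (simp only: distrib_left mult_1_right)
    from this[of RR] show ?case by (simp only: path_count.simps One_nat_def) simp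
  next
    case (Suc y)
    define f :: "int poly" where "f = path_count 0 y"
    define r :: "int poly" where "r = RR"
    define z :: "int poly" where "z = of_nat y"
    have f: "path_count 0 (Suc y) = (z + 1) * f" "path_count 0 (Suc (Suc y)) = (z + 2) * ((z + 1) * f)"
      "path_count 0 (Suc (Suc (Suc y))) = (z + 3) * ((z + 2) * ((z + 1) * f))"
      by (simp_all add: f_def z_def algebra_simps)
    have IH: "2 * path_count 1 y = (z + 2) * ((z + 1) * f) + 2 * r * ((z + 1) * f)"
      using Suc by (simp only: f r_def[symmetric]) simp
    have "2 * path_count 1 (Suc y) = 2 * (z + 2) * ((z + 1) * f) + 2 * r * ((z + 1) * f) + (z + 1) * (2 * path_count 1 y)"
      by (simp only: One_nat_def path_count.simps(4) f r_def[symmetric]) (simp add: z_def algebra_simps)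
    also have "\<dots> = (z + 3) * ((z + 2) * ((z + 1) * f)) + 2 * r * ((z + 2) * ((z + 1) * f))"
      unfolding IH by (simp add: algebra_simps)
    finally show ?case by (simp only: f r_def[symmetric]) simp
  qed
next
  case (Suc n)
  note IH = Suc
  show ?case
  proof (induction y)
    case 0
    have *: "2 * of_nat (Suc n) * path_count (Suc n) 0 = path_count n 2 + 2 * RR * path_count n 1"
       "2 * of_nat (Suc n) * path_count (Suc n) 1 = path_count n 3 + 2 * RR * path_count n 2"
      using IH[of 0] IH[of 1] by (simp_all only: numeral_2_eq_2 numeral_3_eq_3 One_nat_def)
    have e: "path_count (Suc (Suc n)) 0 = path_count (Suc n) 1 + RR * path_count (Suc n) 0"
      "path_count (Suc n) 2 = path_count n 3 + RR * path_count n 2 + 2 * path_count (Suc n) 1"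
      "path_count (Suc n) 1 = path_count n 2 + RR * path_count n 1 + path_count (Suc n) 0"
      by (simp_all only: numeral_2_eq_2 numeral_3_eq_3 One_nat_def path_count.simps) simp_all
    have "2 * (1 + k) * (g1 + r * g0) = 2 * k * g1 + r * (2 * k * g0) + 2 * g1 + 2 * r * g0"
      for k r g0 g1 :: "int poly" by (simp add: algebra_simps)
    from this[of "of_nat (Suc n)"] have "2 * of_nat (Suc (Suc n)) * path_count (Suc (Suc n)) 0
       = 2 * of_nat (Suc n) * path_count (Suc n) 1 + RR * (2 * of_nat (Suc n) * path_count (Suc n) 0)
         + 2 * path_count (Suc n) 1 + 2 * RR * path_count (Suc n) 0"
      by (simp only: e(1) of_nat_Suc[of "Suc n"])
    also have "\<dots> = path_count n 3 + RR * path_count n 2 + 2 * path_count (Suc n) 1 + 2 * RR * (path_count n 2 + RR * path_count n 1 + path_count (Suc n) 0)"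
    proof -
      have "g3 + 2 * r * g2 + r * (g2 + 2 * r * g1) + h1 + 2 * r * h0 = g3 + r * g2 + h1 + 2 * r * (g2 + r * g1 + h0)"
        for r g3 g2 g1 h1 h0 :: "int poly" by (simp add: algebra_simps)
      then show ?thesis unfolding * .
    qed
    also have "\<dots> = path_count (Suc n) 2 + 2 * RR * path_count (Suc n) 1"
      by (simp only: e(2) e(3)[symmetric])
    finally show ?case by (simp only: numeral_2_eq_2 One_nat_def)
  next
    case (Suc y)
    let ?n = "of_nat (Suc n) :: int poly" and ?y = "of_nat (Suc y) :: int poly"
    note * = IH[of "Suc y"] IH[of "Suc (Suc y)"]
    have c: "of_nat (Suc (Suc n)) = ?n + 1" "of_nat (Suc (Suc y)) = ?y + 1"
        "of_nat (Suc (Suc (Suc y))) = ?y + 2" by simp_all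
    have e: "path_count (Suc (Suc n)) (Suc y) = path_count (Suc n) (Suc (Suc y)) + RR * path_count (Suc n) (Suc y) + ?y * path_count (Suc (Suc n)) y"
      "path_count (Suc n) (Suc (Suc (Suc y))) = path_count n (Suc (Suc (Suc (Suc y)))) + RR * path_count n (Suc (Suc (Suc y))) + (?y + 2) * path_count (Suc n) (Suc (Suc y))"
      "path_count (Suc n) (Suc (Suc y)) = path_count n (Suc (Suc (Suc y))) + RR * path_count n (Suc (Suc y)) + (?y + 1) * path_count (Suc n) (Suc y)"
      by (simp_all only: path_count.simps c)
    \<comment> \<open>After a first-step expansion of \<open>a\<close>, the outer hypothesis
      rewrites \<open>2 * N * p\<close> and \<open>2 * N * q\<close>, the inner one
      \<open>2 * (N + 1) * b\<close>.\<close>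
    have "2 * (N + 1) * a = h + 2 * r * p"
      if "2 * (N + 1) * b = p + 2 * r * q" "2 * N * q = s + 2 * r * t" "2 * N * p = w + 2 * r * s"
        and e: "a = p + r * q + Y * b" "h = w + r * s + (Y + 2) * p" "p = s + r * t + (Y + 1) * q"
      for N Y a b h p q r s t w :: "int poly"
    proof -
      have "2 * (N + 1) * a = 2 * N * p + 2 * p + r * (2 * N * q) + 2 * r * q + Y * (2 * (N + 1) * b)"
        unfolding e(1) by (simp add: algebra_simps)
      also have "\<dots> = w + r * s + (Y + 2) * p + 2 * r * (s + r * t + (Y + 1) * q)"
        unfolding that(1-3) by (simp add: algebra_simps)
      finally show ?thesis unfolding e(2) e(3)[symmetric] .
    qed
    from this[OF Suc[unfolded c(1)] * e] show ?case unfolding c(1) .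
  qed
qed

text \<open>Both sides satisfy the same three-term recurrence: two first-step expansions leave
  \<open>path_count n 2\<close>, which \<open>path_count_Suc_upper\<close> at \<open>y = 0\<close>
  eliminates.\<close>

lemma chi_eq_path_count: "chi (Suc n) = RR * path_count n 0"
proof (induction n rule: induct_nat_012)
  case 0
  show ?case by simp
next
  case 1
  show ?case by (simp add: power2_eq_square algebra_simps)
next
  case (ge2 n)
  let ?n = "of_nat (Suc n) :: int poly"
  have "chi (Suc (Suc (Suc n))) = RR ^ 2 * chi (Suc n) + of_nat (2 * Suc n + 1) * chi (Suc (Suc n))"
    by (simp only: chi.simps)
  also have "of_nat (2 * Suc n + 1) = 2 * ?n + 1" by simp
  also have "RR ^ 2 * chi (Suc n) + (2 * ?n + 1) * chi (Suc (Suc n)) = RR * path_count (Suc (Suc n)) 0"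
  proof -
    have e: "path_count (Suc (Suc n)) 0 = path_count (Suc n) (Suc 0) + RR * path_count (Suc n) 0"
      "path_count (Suc n) (Suc 0) = path_count n (Suc (Suc 0)) + RR * path_count n (Suc 0) + path_count (Suc n) 0"
      "path_count (Suc n) 0 = path_count n (Suc 0) + RR * path_count n 0"
      by (simp_all only: path_count.simps One_nat_def) simp_all
    have "r\<^sup>2 * c1 + (k + 1) * c2 = r * g20"
      if e: "g20 = g11 + r * g10" "g11 = g02 + r * g01 + g10" "g10 = g01 + r * g00"
        and k: "k * g10 = g02 + 2 * r * g01" and c: "c1 = r * g00" "c2 = r * g10"
      for r g20 g11 g10 g02 g01 g00 c1 c2 k :: "int poly"
    proof -
      have "r\<^sup>2 * c1 + (k + 1) * c2 = r * (r * (r * g00) + k * g10 + g10)"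
        unfolding c power2_eq_square by (simp only: ring_distribs mult_ac mult_1_left)
      also have "r * (r * g00) + k * g10 + g10 = g11 + r * (g01 + r * g00)"
        unfolding k e(2) mult_2 by (simp only: ring_distribs mult_ac add_ac)
      finally show ?thesis using e by simp
    qed
    from this[OF e path_count_Suc_upper[of n 0] ge2] show ?thesis .
  qed
  finally show ?case .
qed

section \<open>Unitriangular row operations on Hankel matrices\<close>

text \<open>The recurrence in \<open>det_of_recurrence\<close> makes row \<open>y\<close> of \<open>u\<close> a monic polynomial of degree \<open>y\<close> in the shift
  operator applied to row \<open>0\<close>; \<open>step_coeff y\<close> lists its coefficients.\<close>
fun step_coeff :: "nat \<Rightarrow> nat \<Rightarrow> int poly" where
  "step_coeff 0 k = (if k = 0 then 1 else 0)"
| "step_coeff (Suc 0) k = (if k = 0 then - RR else if k = 1 then 1 else 0)"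
| "step_coeff (Suc (Suc i)) k = (case k of 0 \<Rightarrow> 0 | Suc l \<Rightarrow> step_coeff (Suc i) l - of_nat (Suc i) * step_coeff i l)
     - RR * step_coeff (Suc i) k"

lemma step_coeff_above: "i < k \<Longrightarrow> step_coeff i k = 0"
  by (induction i k rule: step_coeff.induct) (auto split: nat.splits)

lemma step_coeff_diag: "step_coeff i i = 1"
  by (induction i rule: induct_nat_012) (auto simp: step_coeff_above)

text \<open>The first matrix is the second multiplied on the left by the lower unitriangular matrix
  of \<open>step_coeff\<close>.\<close>

lemma det_of_recurrence:
  fixes u :: "nat \<Rightarrow> nat \<Rightarrow> int poly"
  assumes u1: "\<And>n. u 1 n = u 0 (Suc n) - RR * u 0 n"
    and u2: "\<And>y n. u (Suc (Suc y)) n = u (Suc y) (Suc n) - RR * u (Suc y) n - of_nat (Suc y) * u y (Suc n)"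
  shows "det (mat N N (\<lambda>(i, j). u i j)) = det (mat N N (\<lambda>(i, j). u 0 (i + j)))"
proof -
  \<comment> \<open>Since \<open>step_coeff i k = 0\<close> for \<open>k > i\<close>, all rows can
    share one bound \<open>K\<close>; the matrix product takes \<open>K = N - 1\<close>.\<close>
  have expand: "u i n = (\<Sum>k\<le>K. step_coeff i k * u 0 (k + n))" if "i \<le> K" for i n K
    using that
  proof (induction i arbitrary: n K rule: induct_nat_012)
    case 0
    have "(\<Sum>k\<le>K. step_coeff 0 k * u 0 (k + n)) = (\<Sum>k\<le>K. if k = 0 then u 0 n else 0)"
      by (intro sum.cong) auto
    thus ?case by simp
  next
    case 1
    then have "(\<Sum>k\<le>K. step_coeff (Suc 0) k * u 0 (k + n)) = (\<Sum>k\<in>{0, 1}. step_coeff (Suc 0) k * u 0 (k + n))"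
      by (intro sum.mono_neutral_right) auto
    then show ?case using u1[of n] by simp
  next
    case (ge2 y)
    then obtain L where L: "K = Suc L" "Suc y \<le> L" by (cases K) auto
    have 1: "u (Suc y) (Suc n) = (\<Sum>l\<le>L. step_coeff (Suc y) l * u 0 (Suc l + n))"
      and 2: "u y (Suc n) = (\<Sum>l\<le>L. step_coeff y l * u 0 (Suc l + n))"
      using ge2(1)[of L "Suc n"] ge2(2)[of L "Suc n"] L(2) by simp_all
    have 3: "u (Suc y) n = (\<Sum>l\<le>K. step_coeff (Suc y) l * u 0 (l + n))"
      using ge2(2)[of K n] L by simp
    have "(\<Sum>k\<le>K. step_coeff (Suc (Suc y)) k * u 0 (k + n)) = 
      (\<Sum>k\<le>K. (case k of 0 \<Rightarrow> 0 | Suc l \<Rightarrow> step_coeff (Suc y) l - of_nat (Suc y) * step_coeff y l) * u 0 (k + n))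
       - RR * (\<Sum>k\<le>K. step_coeff (Suc y) k * u 0 (k + n))"
      by (simp only: step_coeff.simps left_diff_distrib sum_subtractf sum_distrib_left mult.assoc)
    also have "(\<Sum>k\<le>K. (case k of 0 \<Rightarrow> 0 | Suc l \<Rightarrow> step_coeff (Suc y) l - of_nat (Suc y) * step_coeff y l) * u 0 (k + n))
       = (\<Sum>l\<le>L. (step_coeff (Suc y) l - of_nat (Suc y) * step_coeff y l) * u 0 (Suc l + n))"
      unfolding L(1) by (subst sum.atMost_Suc_shift) simp
    also have "\<dots> = u (Suc y) (Suc n) - of_nat (Suc y) * u y (Suc n)"
      unfolding 1 2 by (simp only: left_diff_distrib sum_subtractf sum_distrib_left mult.assoc)
    finally show ?case unfolding u2 3[symmetric] by simp
  qed
  let ?A = "mat N N (\<lambda>(i, j). step_coeff i j)" and ?H = "mat N N (\<lambda>(i, j). u 0 (i + j))"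
  have "mat N N (\<lambda>(i, j). u i j) = ?A * ?H"
  proof (rule eq_matI)
    fix i j assume ij: "i < dim_row (?A * ?H)" "j < dim_col (?A * ?H)"
    then have "{0..<N} = {..N - 1}" by auto
    then show "mat N N (\<lambda>(i, j). u i j) $$ (i, j) = (?A * ?H) $$ (i, j)"
      using ij expand[of i "N - 1" j] by (simp add: scalar_prod_def)
  qed simp_all
  moreover have "det ?A = 1"
    by (subst det_lower_triangular[where n = N])
      (auto simp: step_coeff_above step_coeff_diag prod_list_diag_prod)
  ultimately show ?thesis
    by (simp add: det_mult[where n = N])
qed

subsection \<open>Systems of disjoint paths\<close>

text \<open>The starting points are left free because the later induction moves them, one step at a
  time, from the \<open>Pt i\<close> towards the \<open>Qt i\<close>.\<close>

definition systems :: "nat \<Rightarrow> (nat \<Rightarrow> point) \<Rightarrow> (nat \<Rightarrow> point list) set" where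
  "systems n v = {\<sigma>. (\<forall>i<n. schroeder_path (\<sigma> i) \<and> hd (\<sigma> i) = v i)
             \<and> (\<lambda>i. last (\<sigma> i)) ` {..<n} = Qt ` {..<n}
             \<and> (\<forall>i<n. \<forall>j<n. i \<noteq> j \<longrightarrow> set (\<sigma> i) \<inter> set (\<sigma> j) = {})
             \<and> (\<forall>i\<ge>n. \<sigma> i = [])}"

lemma XX_eq_systems: "XX n = systems n Pt"
  by (simp add: XX_def systems_def)

lemma systemsD:
  assumes "\<sigma> \<in> systems n v"
  shows "i < n \<Longrightarrow> schroeder_path (\<sigma> i)" "i < n \<Longrightarrow> hd (\<sigma> i) = v i"
    "(\<lambda>i. last (\<sigma> i)) ` {..<n} = Qt ` {..<n}"
    "i < n \<Longrightarrow> j < n \<Longrightarrow> i \<noteq> j \<Longrightarrow> set (\<sigma> i) \<inter> set (\<sigma> j) = {}"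
    "n \<le> i \<Longrightarrow> \<sigma> i = []"
  using assms by (auto simp: systems_def)

section \<open>Monotonicity along Schroeder paths\<close>

lemma schroeder_path_single [simp]: "schroeder_path [u]"
  by (simp add: schroeder_path_def)

lemma schroeder_path_Cons:
  "schroeder_path (u # xs) \<longleftrightarrow> xs = [] \<or> schroeder_step u (hd xs) \<and> schroeder_path xs"
  by (cases xs) (auto simp: schroeder_path_def)

lemma schroeder_path_nonempty: "schroeder_path xs \<Longrightarrow> xs \<noteq> []"
  by (simp add: schroeder_path_def)

text \<open>Each step adds 0 or 2 to \<open>x + y\<close> and to \<open>x - y\<close>. This later
  keeps the other paths away from the start of the path that moves.\<close>

lemma schroeder_path_mono:
  assumes "schroeder_path xs" "u \<in> set xs"
  shows "fst (hd xs) + snd (hd xs) \<le> fst u + snd u" "fst (hd xs) - snd (hd xs) \<le> fst u - snd u"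
    "fst (hd xs) \<le> fst u"
  using assms
proof (induction xs)
  case (Cons a xs)
  {
    case 1 then show ?case using Cons
      by (cases "u = a") (auto simp: schroeder_path_Cons schroeder_step_def)
  next
    case 2 then show ?case using Cons
      by (cases "u = a") (auto simp: schroeder_path_Cons schroeder_step_def)
  next
    case 3 then show ?case using Cons
      by (cases "u = a") (auto simp: schroeder_path_Cons schroeder_step_def)
  }
qed simp_all

text \<open>Every step strictly increases \<open>x\<close>, so no path with a step returns to its
  start.\<close>

lemma schroeder_path_closed:
  assumes "schroeder_path xs" "last xs = hd xs"
  shows "xs = [hd xs]"
proof (cases xs)
  case (Cons u ys)
  show ?thesis
  proof (cases "ys = []")
    case False
    then have "schroeder_step u (hd ys)" "schroeder_path ys"
      using assms(1) Cons by (simp_all add: schroeder_path_Cons)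
    with schroeder_path_mono(3)[of ys "last ys"] False have "fst u < fst (last ys)"
      by (auto simp: schroeder_step_def)
    with assms(2) Cons False show ?thesis by simp
  qed (use Cons in simp)
qed (use assms in \<open>simp add: schroeder_path_def\<close>)

lemma path_weight_Cons: "xs \<noteq> [] \<Longrightarrow> path_weight d (u # xs) = step_weight d u (hd xs) * path_weight d xs"
  by (cases xs) (auto simp: path_weight_def)

section \<open>First-step decomposition of path systems\<close>

definition successors :: "point \<Rightarrow> point set" where
  "successors u = {(fst u + 1, snd u + 1), (fst u + 1, snd u - 1), (fst u + 2, snd u)}"

lemma schroeder_step_iff: "schroeder_step u w \<longleftrightarrow> w \<in> successors u"
  by (cases w) (auto simp: schroeder_step_def successors_def)

text \<open>By \<open>nt\<close> path \<open>m\<close> has at least one step, so its first vertex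
  can be removed; by \<open>free\<close>, putting it back keeps the paths disjoint.\<close>

lemma systems_step:
  assumes m: "m < n" and nt: "v m \<notin> Qt ` {..<n}"
    and free: "\<And>i xs. i < n \<Longrightarrow> i \<noteq> m \<Longrightarrow> schroeder_path xs \<Longrightarrow> hd xs = v i \<Longrightarrow> v m \<notin> set xs"
  shows "systems n v = (\<Union>w\<in>successors (v m). (\<lambda>\<sigma>. \<sigma>(m := v m # \<sigma> m)) ` systems n (v(m := w)))"
proof (intro equalityI subsetI)
  fix \<sigma> assume S: "\<sigma> \<in> systems n v"
  note D = systemsD[OF S]
  obtain xs where xs: "\<sigma> m = v m # xs"
    using schroeder_path_nonempty[OF D(1)[OF m]] D(2)[OF m] by (cases "\<sigma> m") auto
  have "last (\<sigma> m) \<in> Qt ` {..<n}" using D(3) m by blast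
  then have ne: "xs \<noteq> []" using nt xs by auto
  then have w: "hd xs \<in> successors (v m)" "schroeder_path xs"
    using D(1)[OF m] by (auto simp: xs schroeder_path_Cons schroeder_step_iff)
  let ?\<tau> = "\<sigma>(m := xs)"
  have "?\<tau> \<in> systems n (v(m := hd xs))"
    unfolding systems_def
  proof (intro CollectI conjI allI impI)
    show "(\<lambda>i. last (?\<tau> i)) ` {..<n} = Qt ` {..<n}"
      unfolding D(3)[symmetric] using ne by (intro image_cong) (auto simp: xs)
  next
    fix i j assume ij: "i < n" "j < n" "i \<noteq> j"
    have "set (?\<tau> i) \<subseteq> set (\<sigma> i)" "set (?\<tau> j) \<subseteq> set (\<sigma> j)" by (auto simp: xs)
    then show "set (?\<tau> i) \<inter> set (?\<tau> j) = {}" using D(4)[OF ij] by blast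
  qed (use w m D in auto)
  moreover have "\<sigma> = ?\<tau>(m := v m # ?\<tau> m)" using xs by auto
  ultimately show "\<sigma> \<in> (\<Union>w\<in>successors (v m). (\<lambda>\<sigma>. \<sigma>(m := v m # \<sigma> m)) ` systems n (v(m := w)))"
    using w by blast
next
  fix \<sigma> assume "\<sigma> \<in> (\<Union>w\<in>successors (v m). (\<lambda>\<sigma>. \<sigma>(m := v m # \<sigma> m)) ` systems n (v(m := w)))"
  then obtain w \<tau> where w: "w \<in> successors (v m)" and S: "\<tau> \<in> systems n (v(m := w))"
    and \<sigma>: "\<sigma> = \<tau>(m := v m # \<tau> m)" by blast
  note D = systemsD[OF S]
  have ne: "\<tau> m \<noteq> []" using schroeder_path_nonempty[OF D(1)[OF m]] .
  have new: "v m \<notin> set (\<tau> i)" if "i < n" "i \<noteq> m" for i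
    using free[OF that, of "\<tau> i"] D(1,2)[of i] that by simp
  show "\<sigma> \<in> systems n v"
    unfolding systems_def
  proof (intro CollectI conjI allI impI)
    show "(\<lambda>i. last (\<sigma> i)) ` {..<n} = Qt ` {..<n}"
      unfolding D(3)[symmetric] using ne by (intro image_cong) (auto simp: \<sigma>)
  next
    fix i j assume ij: "i < n" "j < n" "i \<noteq> j"
    show "set (\<sigma> i) \<inter> set (\<sigma> j) = {}" using D(4)[OF ij] new ij by (auto simp: \<sigma>)
  next
    fix i assume "i < n"
    then show "schroeder_path (\<sigma> i)" "hd (\<sigma> i) = v i"
      using D(1,2)[of i] w by (auto simp: \<sigma> schroeder_path_Cons schroeder_step_iff)
  qed (use m D in \<open>auto simp: \<sigma>\<close>)
qed

lemma coll_weight_Cons: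
  assumes "m < n" "\<tau> m \<noteq> []"
  shows "coll_weight d n (\<tau>(m := u # \<tau> m)) = step_weight d u (hd (\<tau> m)) * coll_weight d n \<tau>"
proof -
  have "coll_weight d n (\<tau>(m := u # \<tau> m))
      = path_weight d (u # \<tau> m) * (\<Prod>i\<in>{..<n} - {m}. path_weight d (\<tau> i))"
    unfolding coll_weight_def using assms by (subst prod.remove[of _ m]) (auto intro: prod.cong)
  also have "\<dots> = step_weight d u (hd (\<tau> m)) * coll_weight d n \<tau>"
    unfolding coll_weight_def using assms by (subst (2) prod.remove[of _ m]) (auto simp: path_weight_Cons)
  finally show ?thesis .
qed

text \<open>The union is disjoint because the head of path \<open>m\<close> determines
  \<open>w\<close>, and prepending \<open>v m\<close> is injective.\<close>

lemma sum_systems_step: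
  assumes m: "m < n" 
    and S: "systems n v = (\<Union>w\<in>successors (v m). (\<lambda>\<sigma>. \<sigma>(m := v m # \<sigma> m)) ` systems n (v(m := w)))"
    and fin: "\<And>w. w \<in> successors (v m) \<Longrightarrow> finite (systems n (v(m := w)))"
  shows "finite (systems n v)"
    and "(\<Sum>\<sigma>\<in>systems n v. coll_weight d n \<sigma>) = (\<Sum>w\<in>successors (v m). step_weight d (v m) w *
           (\<Sum>\<sigma>\<in>systems n (v(m := w)). coll_weight d n \<sigma>))"
proof -
  let ?f = "\<lambda>\<sigma>. \<sigma>(m := v m # \<sigma> m)"
  have finS: "finite (successors (v m))" by (simp add: successors_def)
  show "finite (systems n v)" unfolding S using fin finS by blast
  have hd: "\<tau> m \<noteq> [] \<and> hd (\<tau> m) = w" if "\<tau> \<in> systems n (v(m := w))" for \<tau> w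
    using systemsD(1,2)[OF that m] by (simp add: schroeder_path_nonempty)
  have inj: "inj ?f"
    by (rule injI) (metis fun_upd_idem_iff fun_upd_same fun_upd_upd list.inject)
  have "(\<Sum>\<sigma>\<in>systems n v. coll_weight d n \<sigma>)
      = (\<Sum>w\<in>successors (v m). \<Sum>\<sigma>\<in>?f ` systems n (v(m := w)). coll_weight d n \<sigma>)"
    unfolding S
  proof (intro sum.UNION_disjoint finS ballI impI finite_imageI fin)
    fix w w' :: point assume "w \<noteq> w'"
    then have "systems n (v(m := w)) \<inter> systems n (v(m := w')) = {}" using hd by blast
    then show "?f ` systems n (v(m := w)) \<inter> ?f ` systems n (v(m := w')) = {}"
      by (simp add: image_Int[OF inj, symmetric])
  qed auto
  also have "\<dots> = (\<Sum>w\<in>successors (v m). step_weight d (v m) w *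
           (\<Sum>\<sigma>\<in>systems n (v(m := w)). coll_weight d n \<sigma>))"
    using hd m
    by (intro sum.cong refl) (simp add: sum.reindex[OF inj_on_subset[OF inj]] sum_distrib_left coll_weight_Cons)
  finally show "(\<Sum>\<sigma>\<in>systems n v. coll_weight d n \<sigma>) = \<dots>" .
qed

lemma sum_successors:
  "(\<Sum>w\<in>successors (x, y). step_weight d (x, y) w * h w)
     = h (x + 1, y + 1) + RR * h (x + 2, y) + [: of_int (y + d) :] * h (x + 1, y - 1)"
  by (simp add: successors_def step_weight_def)

text \<open>The cofactors along row \<open>m\<close> do not involve that row. This is the
  determinant side of \<open>sum_systems_step\<close>.\<close>

lemma det_row_combination:
  fixes f :: "'b \<Rightarrow> nat \<Rightarrow> 'a :: comm_ring_1"
  assumes m: "m < n"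
    and row: "\<And>j. j < n \<Longrightarrow> f (v m) j = p * f x j + q * f y j + r * f z j"
  shows "det (mat n n (\<lambda>(i, j). f (v i) j)) = p * det (mat n n (\<lambda>(i, j). f ((v(m := x)) i) j))
     + q * det (mat n n (\<lambda>(i, j). f ((v(m := y)) i) j)) + r * det (mat n n (\<lambda>(i, j). f ((v(m := z)) i) j))"
proof -
  define M where "M v = mat n n (\<lambda>(i, j). f (v i) j)" for v :: "nat \<Rightarrow> 'b"
  have cof: "cofactor (M (v(m := w))) m j = cofactor (M v) m j" if "j < n" for v w j
  proof -
    have "mat_delete (M (v(m := w))) m j = mat_delete (M v) m j"
      by (rule eq_matI) (auto simp: mat_delete_def M_def)
    then show ?thesis by (simp add: cofactor_def)
  qed
  have exp: "det (M (v(m := w))) = (\<Sum>j<n. f w j * cofactor (M v) m j)" for w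
    by (subst laplace_expansion_row[of _ n m]) (use m cof in \<open>auto simp: M_def intro!: sum.cong\<close>)
  have "det (M v) = (\<Sum>j<n. f (v m) j * cofactor (M v) m j)" using exp[of "v m"] by simp
  also have "\<dots> = (\<Sum>j<n. p * (f x j * cofactor (M v) m j) + q * (f y j * cofactor (M v) m j)
      + r * (f z j * cofactor (M v) m j))"
    by (intro sum.cong refl) (simp add: row algebra_simps)
  also have "\<dots> = p * det (M (v(m := x))) + q * det (M (v(m := y))) + r * det (M (v(m := z)))"
    unfolding exp by (simp add: sum.distrib sum_distrib_left)
  finally show ?thesis unfolding M_def .
qed

section \<open>Rotated coordinates and the Lindstroem--Gessel--Viennot argument\<close>

text \<open>In the rotated coordinates \<open>a = (x + y) / 2\<close>, \<open>b = (x - y) / 2\<close> every step increases \<open>a\<close> or \<open>b\<close>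
  by one, or both; \<open>P\<^sub>i\<close> is \<open>(0, -i)\<close> and \<open>Q\<^sub>i\<close> is \<open>(i, 0)\<close>.\<close>
definition rotated_point :: "int \<times> int \<Rightarrow> point" where
  "rotated_point c = (fst c + snd c, fst c - snd c)"

lemma systems_empty_of_collision:
  assumes "i < n" "j < n" "i \<noteq> j" "v i = v j"
  shows "systems n v = {}"
proof (rule equals0I)
  fix \<sigma> assume S: "\<sigma> \<in> systems n v"
  have "v i \<in> set (\<sigma> i)" "v j \<in> set (\<sigma> j)"
    using systemsD(1,2)[OF S] assms by (metis hd_in_set schroeder_path_nonempty)+
  then show False using systemsD(4)[OF S assms(1-3)] assms(4) by auto
qed

text \<open>\<open>x + y\<close> never decreases along a path, and it is at most
  \<open>2 * (n - 1)\<close> at the targets.\<close>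

lemma systems_empty_of_far:
  assumes "i < n" "fst (v i) + snd (v i) \<ge> 2 * int n"
  shows "systems n v = {}"
proof (rule equals0I)
  fix \<sigma> assume S: "\<sigma> \<in> systems n v"
  have P: "schroeder_path (\<sigma> i)" "hd (\<sigma> i) = v i" using systemsD(1,2)[OF S assms(1)] .
  have "last (\<sigma> i) \<in> Qt ` {..<n}" using systemsD(3)[OF S] assms(1) by blast
  moreover have "fst (v i) + snd (v i) \<le> fst (last (\<sigma> i)) + snd (last (\<sigma> i))"
    using schroeder_path_mono(1)[OF P(1)] P schroeder_path_nonempty[OF P(1)] by auto
  ultimately show False using assms(2) by (auto simp: Qt_def)
qed

text \<open>If path \<open>i\<close> ends at \<open>Qt j\<close>, it meets path \<open>j\<close> at
  the start of the latter; so \<open>i = j\<close>, and path \<open>i\<close> is closed, hence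
  trivial.\<close>

lemma systems_at_targets:
  assumes v: "\<And>i. i < n \<Longrightarrow> v i = Qt i"
  shows "systems n v = {\<lambda>i. if i < n then [Qt i] else []}"
proof (intro equalityI subsetI)
  fix \<sigma> assume S: "\<sigma> \<in> systems n v"
  have "\<sigma> i = [Qt i]" if i: "i < n" for i
  proof -
    have P: "schroeder_path (\<sigma> k)" "hd (\<sigma> k) = Qt k" if "k < n" for k
      using systemsD(1,2)[OF S that] v[OF that] by auto
    have "last (\<sigma> i) \<in> Qt ` {..<n}" using systemsD(3)[OF S] i by blast
    then obtain j where j: "j < n" "last (\<sigma> i) = Qt j" by auto
    have "Qt j \<in> set (\<sigma> j)" using P[OF j(1)] by (metis hd_in_set schroeder_path_nonempty)
    moreover have "Qt j \<in> set (\<sigma> i)" using P[OF i] j by (metis last_in_set schroeder_path_nonempty)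
    ultimately have "i = j" using systemsD(4)[OF S i j(1)] by auto
    then show ?thesis using schroeder_path_closed[OF P(1)[OF i]] P(2)[OF i] j(2) by simp
  qed
  then show "\<sigma> \<in> {\<lambda>i. if i < n then [Qt i] else []}"
    using systemsD(5)[OF S] by (auto simp: fun_eq_iff)
next
  have "inj Qt" by (auto simp: inj_def Qt_def)
  fix \<sigma> assume "\<sigma> \<in> {\<lambda>i. if i < n then [Qt i] else []}"
  then show "\<sigma> \<in> systems n v" using v inj_eq[OF \<open>inj Qt\<close>] by (auto simp: systems_def)
qed

text \<open>Induction upwards from 0 gives the lower bound, downwards from \<open>n - 1\<close> the
  upper one.\<close>

lemma strict_mono_on_segment_eq:
  fixes a :: "nat \<Rightarrow> int"
  assumes mono: "\<And>i j. i < j \<Longrightarrow> j < n \<Longrightarrow> a i < a j"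
    and bd: "\<And>i. i < n \<Longrightarrow> 0 \<le> a i \<and> a i < int n" and i: "i < n"
  shows "a i = int i"
proof -
  have lo: "int i \<le> a i" if "i < n" for i
    using that
  proof (induction i)
    case (Suc i) then show ?case using mono[of i "Suc i"] by simp
  qed (use bd in auto)
  have up: "a (n - 1 - k) \<le> int (n - 1 - k)" if "k < n" for k
    using that
  proof (induction k)
    case 0 then show ?case using bd[of "n - 1"] by auto
  next
    case (Suc k)
    then have "n - 1 - k = Suc (n - 1 - Suc k)" by simp
    with Suc mono[of "n - 1 - Suc k" "n - 1 - k"] show ?case by simp
  qed
  show ?thesis using lo[OF i] up[of "n - 1 - i"] i by simp
qed

text \<open>A Lindstroem--Gessel--Viennot lemma without signs. As long as a path has not reached \<open>b = 0\<close>, the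
  first path \<open>m\<close> of lowest \<open>b\<close> makes a step: the determinant is linear in row \<open>m\<close>, prepending the old
  starting point creates no intersection, and the north-west to south-east order of the starting
  points is preserved or two of them collide, which annihilates both sides.\<close>
lemma det_eq_sum_systems:
  fixes V :: "int \<times> int \<Rightarrow> nat \<Rightarrow> int poly"
  assumes rec: "\<And>a b j. 0 \<le> a \<Longrightarrow> b < 0 \<Longrightarrow> j < n \<Longrightarrow>
      V (a, b) j = V (a + 1, b) j + RR * V (a + 1, b + 1) j + [: a - b + d :] * V (a, b + 1) j"
    and zero: "\<And>a b j. int j < a \<Longrightarrow> b \<le> 0 \<Longrightarrow> V (a, b) j = 0"
    and dom: "\<And>i. i < n \<Longrightarrow> 0 \<le> fst (c i) \<and> snd (c i) \<le> 0"
    and ord: "\<And>i j. i < j \<Longrightarrow> j < n \<Longrightarrow> fst (c i) \<le> fst (c j) \<and> snd (c j) \<le> snd (c i)"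
  shows "finite (systems n (rotated_point \<circ> c)) \<and>
    det (mat n n (\<lambda>(i, j). V (c i) j))
      = (\<Prod>i<n. V (int i, 0) i) * (\<Sum>\<sigma>\<in>systems n (rotated_point \<circ> c). coll_weight d n \<sigma>)"
  using dom ord
\<comment> \<open>The measure is the total distance to \<open>a = n\<close> and
  \<open>b = 0\<close>; a moving point has \<open>a < n\<close> and \<open>b < 0\<close>, so each of
  its three steps shortens it.\<close>
proof (induction "\<Sum>i<n. nat (int n - fst (c i)) + nat (- snd (c i))" arbitrary: c rule: less_induct)
  case less
  note dom = less.prems(1) and ord = less.prems(2)
  let ?C = "\<Prod>i<n. V (int i, 0) i"
  let ?M = "\<lambda>c. mat n n (\<lambda>(i, j). V (c i) j)"
  consider (coll) i j where "i < j" "j < n" "c i = c j"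
    | (far) i where "i < n" "int n \<le> fst (c i)"
    | (fin) "\<And>i j. i < j \<Longrightarrow> j < n \<Longrightarrow> c i \<noteq> c j" "\<And>i. i < n \<Longrightarrow> fst (c i) < int n" "\<And>i. i < n \<Longrightarrow> snd (c i) = 0"
    | (step) k where "\<And>i j. i < j \<Longrightarrow> j < n \<Longrightarrow> c i \<noteq> c j" "\<And>i. i < n \<Longrightarrow> fst (c i) < int n" "k < n" "snd (c k) \<noteq> 0"
    by (metis linorder_not_less)
  then show ?case
  proof cases
    case coll
    have "det (?M c) = 0"
      by (rule det_identical_rows[of _ n i j]) (use coll in \<open>auto intro!: eq_vecI\<close>)
    then show ?thesis using systems_empty_of_collision[of i n j "rotated_point \<circ> c"] coll by simp
  next
    case far
    have "det (?M c) = 0"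
      by (subst laplace_expansion_row[of _ n i])
        (use far zero[of _ "fst (c i)" "snd (c i)"] dom[of i] in \<open>auto intro!: sum.neutral\<close>)
    moreover have "systems n (rotated_point \<circ> c) = {}"
      by (rule systems_empty_of_far[of i]) (use far in \<open>auto simp: rotated_point_def\<close>)
    ultimately show ?thesis by simp
  next
    case fin
    have c: "c i = (int i, 0)" if i: "i < n" for i
    proof -
      have "fst (c i) = int i"
      proof (rule strict_mono_on_segment_eq[of n "fst \<circ> c", unfolded o_def, OF _ _ i])
        fix i j assume "i < j" "j < n"
        then show "fst (c i) < fst (c j)" using fin(1)[of i j] fin(3)[of i] fin(3)[of j] ord[of i j]
          by (simp add: prod_eq_iff)
      qed (use fin(2) dom in auto)
      then show ?thesis using fin(3)[OF i] by (simp add: prod_eq_iff)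
    qed
    have "det (?M c) = ?C"
      by (subst det_upper_triangular[where n = n])
        (auto simp: upper_triangular_def c zero prod_list_diag_prod atLeast0LessThan intro!: prod.cong)
    moreover have "systems n (rotated_point \<circ> c) = {\<lambda>i. if i < n then [Qt i] else []}"
      by (rule systems_at_targets) (simp add: c rotated_point_def Qt_def)
    moreover have "coll_weight d n (\<lambda>i. if i < n then [Qt i] else []) = 1"
      by (simp add: coll_weight_def path_weight_def)
    ultimately show ?thesis by simp
  next
    case step
    \<comment> \<open>By \<open>ord\<close> the lowest \<open>b\<close> occurs at index
      \<open>n - 1\<close>; \<open>m\<close> is the first index attaining it, so later points share
      its \<open>b\<close> and have larger \<open>a\<close>.\<close>
    define m where "m = (LEAST i. i < n \<and> snd (c i) = snd (c (n - 1)))"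
    have n: "0 < n" using step(3) by simp
    have m: "m < n" "snd (c m) = snd (c (n - 1))"
      using LeastI[of "\<lambda>i. i < n \<and> snd (c i) = snd (c (n - 1))" "n - 1"] n by (auto simp: m_def)
    have bot: "snd (c m) \<le> snd (c i)" if "i < n" for i
      using ord[of i "n - 1"] m(2) that by (cases "i = n - 1") auto
    have before: "snd (c m) < snd (c i)" if "i < m" for i
    proof -
      have "snd (c i) \<noteq> snd (c m)"
        using not_less_Least[of i "\<lambda>i. i < n \<and> snd (c i) = snd (c (n - 1))"] that m by (auto simp: m_def)
      then show ?thesis using bot[of i] that m(1) by simp
    qed
    have after: "snd (c i) = snd (c m)" "fst (c m) < fst (c i)" if "m < i" "i < n" for i
    proof -
      show "snd (c i) = snd (c m)" using ord[OF that] bot[OF that(2)] by simp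
      then show "fst (c m) < fst (c i)" using ord[OF that] step(1)[OF that] by (auto simp: prod_eq_iff)
    qed
    obtain a b where ab: "c m = (a, b)" by (cases "c m")
    have b: "b < 0" using bot[OF step(3)] dom[OF step(3)] step(4) ab by simp
    have a: "0 \<le> a" "a < int n" using dom[OF m(1)] step(2)[OF m(1)] ab by simp_all
    have IH: "finite (systems n (rotated_point \<circ> c(m := w))) \<and>
       det (?M (c(m := w))) = ?C * (\<Sum>\<sigma>\<in>systems n (rotated_point \<circ> c(m := w)). coll_weight d n \<sigma>)"
      if w: "w \<in> {(a + 1, b), (a + 1, b + 1), (a, b + 1)}" for w
    proof (rule less.hyps)
      show "(\<Sum>i<n. nat (int n - fst ((c(m := w)) i)) + nat (- snd ((c(m := w)) i)))
          < (\<Sum>i<n. nat (int n - fst (c i)) + nat (- snd (c i)))"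
        by (rule sum_strict_mono_ex1) (use w a b m(1) ab in auto)
    next
      fix i assume "i < n"
      then show "0 \<le> fst ((c(m := w)) i) \<and> snd ((c(m := w)) i) \<le> 0" using dom w a b by auto
    next
      \<comment> \<open>Earlier points have \<open>b\<close> larger by at least 1, later ones have
        \<open>a\<close> larger by at least 1, so a unit move of point \<open>m\<close> overtakes
        none.\<close>
      fix i j assume "i < j" "j < n"
      then show "fst ((c(m := w)) i) \<le> fst ((c(m := w)) j) \<and> snd ((c(m := w)) j) \<le> snd ((c(m := w)) i)"
        using ord[of i j] before[of i] after[of j] w ab by auto
    qed
    have upd: "rotated_point \<circ> c(m := w) = (rotated_point \<circ> c)(m := rotated_point w)" for w by auto
    have succ: "successors ((rotated_point \<circ> c) m) = rotated_point ` {(a + 1, b), (a + 1, b + 1), (a, b + 1)}"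
      by (auto simp: successors_def rotated_point_def ab)
    have S: "systems n (rotated_point \<circ> c) = (\<Union>w\<in>successors ((rotated_point \<circ> c) m).
        (\<lambda>\<sigma>. \<sigma>(m := (rotated_point \<circ> c) m # \<sigma> m)) ` systems n ((rotated_point \<circ> c)(m := w)))"
    proof (rule systems_step[OF m(1)])
      show "(rotated_point \<circ> c) m \<notin> Qt ` {..<n}" using b by (auto simp: rotated_point_def Qt_def ab)
    next
      fix i xs assume i: "i < n" "i \<noteq> m" and xs: "schroeder_path xs" "hd xs = (rotated_point \<circ> c) i"
      show "(rotated_point \<circ> c) m \<notin> set xs"
      proof
        assume "(rotated_point \<circ> c) m \<in> set xs"
        \<comment> \<open>A path through point \<open>m\<close> starts weakly below it in both
          rotated coordinates, but earlier starts exceed it in \<open>b\<close> and later ones in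
          \<open>a\<close>.\<close>
        from schroeder_path_mono(1,2)[OF xs(1) this] have "fst (c i) \<le> a" "snd (c i) \<le> b"
          by (auto simp: xs rotated_point_def ab)
        with before[of i] after[of i] i ab show False by (cases "i < m") auto
      qed
    qed
    have fin: "finite (systems n ((rotated_point \<circ> c)(m := w)))" if "w \<in> successors ((rotated_point \<circ> c) m)" for w
      using that IH unfolding succ upd by auto
    have finS: "finite (systems n (rotated_point \<circ> c))"
      by (rule sum_systems_step(1)[OF m(1) S fin])
    have sumS: "(\<Sum>\<sigma>\<in>systems n (rotated_point \<circ> c). coll_weight d n \<sigma>)
       = (\<Sum>w\<in>successors ((rotated_point \<circ> c) m). step_weight d ((rotated_point \<circ> c) m) w *
           (\<Sum>\<sigma>\<in>systems n ((rotated_point \<circ> c)(m := w)). coll_weight d n \<sigma>))"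
      by (rule sum_systems_step(2)[OF m(1) S fin])
    have "?C * (\<Sum>\<sigma>\<in>systems n (rotated_point \<circ> c). coll_weight d n \<sigma>)
       = det (?M (c(m := (a + 1, b)))) + RR * det (?M (c(m := (a + 1, b + 1)))) +
         [: a - b + d :] * det (?M (c(m := (a, b + 1))))"
    proof -
      have pt: "(rotated_point \<circ> c) m = (a + b, a - b)" "rotated_point (a + 1, b) = (a + b + 1, a - b + 1)"
        "rotated_point (a + 1, b + 1) = (a + b + 2, a - b)" "rotated_point (a, b + 1) = (a + b + 1, a - b - 1)"
        by (auto simp: rotated_point_def ab)
      show ?thesis
        using IH[of "(a + 1, b)"] IH[of "(a + 1, b + 1)"] IH[of "(a, b + 1)"]
        unfolding sumS upd unfolding pt sum_successors
        by (simp add: algebra_simps del: mult_pCons_left mult_pCons_right)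
    qed
    also have "\<dots> = det (?M c)"
      by (subst det_row_combination[where v = c and p = 1 and q = RR and r = "[: a - b + d :]" and
            x = "(a + 1, b)" and y = "(a + 1, b + 1)" and z = "(a, b + 1)", OF m(1)])
        (use rec[OF a(1) b] ab in simp_all)
    finally show ?thesis using finS by simp
  qed
qed

subsection \<open>The two Hankel determinants\<close>

lemma det_first_column_unit:
  fixes A :: "'a :: comm_ring_1 mat"
  assumes A: "A \<in> carrier_mat (Suc n) (Suc n)" and col: "\<And>i. i \<le> n \<Longrightarrow> A $$ (i, 0) = (if i = 0 then 1 else 0)"
  shows "det A = det (mat n n (\<lambda>(i, j). A $$ (Suc i, Suc j)))"
proof -
  have "det A = (\<Sum>i<Suc n. A $$ (i, 0) * cofactor A i 0)"
    by (rule laplace_expansion_column[OF A]) simp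
  also have "\<dots> = (\<Sum>i<Suc n. if i = 0 then cofactor A i 0 else 0)"
    by (intro sum.cong) (auto simp: col)
  also have "\<dots> = cofactor A 0 0" by (simp del: sum.lessThan_Suc)
  also have "\<dots> = det (mat_delete A 0 0)" by (simp add: cofactor_def)
  also have "mat_delete A 0 0 = mat n n (\<lambda>(i, j). A $$ (Suc i, Suc j))"
    using A by (auto simp: mat_delete_def)
  finally show ?thesis .
qed

lemma det_scaled: "det (mat n n (\<lambda>(i, j). r * f i j)) = r ^ n * det (mat n n (\<lambda>(i, j). f i j))"
  for r :: "'a :: comm_ring_1"
proof -
  have "mat n n (\<lambda>(i, j). r * f i j) = r \<cdot>\<^sub>m mat n n (\<lambda>(i, j). f i j)" by auto
  then show ?thesis by simp
qed

text \<open>This form covers \<open>y = 0\<close> too: the truncated \<open>y - 1\<close> is then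
  multiplied by 0.\<close>

lemma path_count_rec: "path_count (Suc n) y = path_count n (Suc y) + RR * path_count n y + [: int y :] * path_count (Suc n) (y - 1)"
  by (cases y) (simp_all add: of_nat_poly del: mult_pCons_left)

lemma path_count_0_rec: "0 < y \<Longrightarrow> path_count 0 y = [: int y :] * path_count 0 (y - 1)"
  by (cases y) (simp_all add: of_nat_poly del: mult_pCons_left)

lemma rotated_point_column: "rotated_point \<circ> (\<lambda>i. (0, - int i)) = Pt"
  by (auto simp: rotated_point_def Pt_def)

section \<open>Row reduction of the two Hankel determinants\<close>

lemma det_chi_shift_0:
  "det (mat (Suc p) (Suc p) (\<lambda>(i, j). chi (i + j))) = RR ^ p * det (mat p p (\<lambda>(i, j). path_count j (Suc i)))"
proof -
  \<comment> \<open>\<open>chi 0 = 1\<close> lacks the factor \<open>RR\<close>, so column 0 is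
    added by hand; the recurrence forces zeros below the 1, as in
    \<open>u 1 0 = chi 1 - RR * chi 0 = 0\<close>. This unit column is deleted at the end.\<close>
  define u where "u y n = (if y = 0 then chi n else case n of 0 \<Rightarrow> 0 | Suc m \<Rightarrow> RR * path_count m y)" for y n
  have "det (mat (Suc p) (Suc p) (\<lambda>(i, j). chi (i + j))) = det (mat (Suc p) (Suc p) (\<lambda>(i, j). u 0 (i + j)))"
    by (simp add: u_def)
  also have "\<dots> = det (mat (Suc p) (Suc p) (\<lambda>(i, j). u i j))"
  proof (rule det_of_recurrence[symmetric])
    fix n show "u 1 n = u 0 (Suc n) - RR * u 0 n"
    proof (cases n)
      case 0 then show ?thesis by (simp add: u_def)
    next
      case (Suc m)
      have "RR * path_count m 1 = RR * (path_count m 1 + RR * path_count m 0) - RR * (RR * path_count m 0)"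
        by (simp only: ring_distribs)
      then show ?thesis unfolding Suc by (simp only: u_def chi_eq_path_count path_count.simps(3)) simp
    qed
  next
    fix y n show "u (Suc (Suc y)) n = u (Suc y) (Suc n) - RR * u (Suc y) n - of_nat (Suc y) * u y (Suc n)"
    proof (cases n)
      case 0 then show ?thesis by (cases y) (auto simp: u_def algebra_simps)
    next
      case (Suc m)
      have "u y (Suc (Suc m)) = RR * path_count (Suc m) y" 
        unfolding u_def by (cases y) (simp_all only: chi_eq_path_count if_True if_False nat.case, auto)
      moreover have "r * g2 = r * (g2 + r * g1 + k * g0) - r * (r * g1) - k * (r * g0)" for r g0 g1 g2 k :: "int poly"
        by (simp add: algebra_simps)
      ultimately show ?thesis unfolding Suc by (simp only: path_count.simps(4)) (simp only: u_def, simp only: nat.case path_count.simps(4), auto)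
    qed
  qed
  also have "\<dots> = det (mat p p (\<lambda>(i, j). RR * path_count j (Suc i)))"
    by (subst det_first_column_unit[where n = p]) (auto simp: u_def intro!: arg_cong[where f = det] eq_matI split: nat.splits)
  also have "\<dots> = RR ^ p * det (mat p p (\<lambda>(i, j). path_count j (Suc i)))" by (rule det_scaled)
  finally show ?thesis .
qed

text \<open>All indices are at least 2, so every entry has the factor \<open>RR\<close> and no extra
  column arises.\<close>

lemma det_chi_shift_2:
  "det (mat n n (\<lambda>(i, j). chi (i + j + 2))) = RR ^ n * det (mat n n (\<lambda>(i, j). path_count (Suc j) i))"
proof -
  have "chi (i + j + 2) = RR * path_count (Suc (i + j)) 0" for i j
    using chi_eq_path_count[of "Suc (i + j)"] by simp
  then have "det (mat n n (\<lambda>(i, j). chi (i + j + 2))) = RR ^ n * det (mat n n (\<lambda>(i, j). path_count (Suc (i + j)) 0))"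
    by (simp only: det_scaled)
  also have "det (mat n n (\<lambda>(i, j). path_count (Suc (i + j)) 0)) = det (mat n n (\<lambda>(i, j). path_count (Suc j) i))"
    by (rule det_of_recurrence[of "\<lambda>y n. path_count (Suc n) y", symmetric]) simp_all
  finally show ?thesis .
qed

section \<open>Evaluation by disjoint path systems\<close>

lemma det_path_count_systems_0:
  "det (mat p p (\<lambda>(i, j). path_count j (Suc i))) = of_nat (sf p) * (\<Sum>\<sigma>\<in>XX p. W0 p \<sigma>)"
proof -
  \<comment> \<open>On the domain, \<open>V (a, b) j\<close> counts paths from height
    \<open>a - b\<close> down to height -1 with \<open>j - a\<close> ascents and flat steps. Raising
    heights by 1 turns the descent weight \<open>y + 1\<close> of \<open>W0\<close> into the one in
    \<open>path_count\<close>.\<close>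
  define V where "V c j = (if fst c \<le> int j then path_count (nat (int j - fst c)) (nat (fst c - snd c + 1)) else 0)"
    for c :: "int \<times> int" and j :: nat
  have "det (mat p p (\<lambda>(i, j). V (0, - int i) j))
      = (\<Prod>i<p. V (int i, 0) i) * (\<Sum>\<sigma>\<in>systems p (rotated_point \<circ> (\<lambda>i. (0, - int i))). coll_weight 1 p \<sigma>)"
  proof (rule conjunct2[OF det_eq_sum_systems])
    fix a b :: int and j :: nat assume ab: "0 \<le> a" "b < 0"
    define y where "y = nat (a - b + 1)"
    have y: "nat (a - b + 1) = y" "nat (a + 1 - b + 1) = Suc y" "nat (a + 1 - (b + 1) + 1) = y"
      "nat (a - (b + 1) + 1) = y - 1" "a - b + 1 = int y" "0 < y" using ab by (auto simp: y_def)
    consider "a > int j" | "a = int j" | "a < int j" by linarith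
    then show "V (a, b) j = V (a + 1, b) j + RR * V (a + 1, b + 1) j + [:a - b + 1:] * V (a, b + 1) j"
    proof cases
      case 3
      define k where "k = nat (int j - a - 1)"
      have k: "nat (int j - a) = Suc k" "nat (int j - (a + 1)) = k" using 3 by (auto simp: k_def)
      show ?thesis using 3 path_count_rec[of k y] by (simp only: V_def fst_conv snd_conv y k) simp
    qed (use path_count_0_rec[of y] y in \<open>simp_all only: V_def fst_conv snd_conv y, simp_all\<close>)
  qed (auto simp: V_def)
  \<comment> \<open>The diagonal entries are \<open>(i + 1)!\<close> for \<open>i < p\<close>; the
    factor \<open>0! = 1\<close> completes \<open>sf p\<close>.\<close>
  moreover have "(\<Prod>i<p. V (int i, 0) i) = of_nat (sf p)"
  proof -
    have "(\<Prod>i<p. V (int i, 0) i) = (\<Prod>i<p. fact (Suc i))"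
      by (intro prod.cong) (auto simp: V_def nat_add_distrib path_count_0)
    also have "\<dots> = of_nat (sf p)"
      by (simp add: sf_def prod.atMost_shift algebra_simps)
    finally show ?thesis .
  qed
  moreover have "V (0, - int i) j = path_count j (Suc i)" for i j
    by (simp add: V_def nat_add_distrib)
  ultimately show ?thesis by (simp add: rotated_point_column XX_eq_systems W0_def)
qed

text \<open>Heights are now lowered by 1, to match the descent weight \<open>y - 1\<close> of
  \<open>W2\<close>.\<close>

lemma det_path_count_systems_2:
  "det (mat (Suc p) (Suc p) (\<lambda>(i, j). path_count (Suc j) i)) = of_nat (sf p) * (\<Sum>\<sigma>\<in>XX (p + 2). W2 (p + 2) \<sigma>)"
proof -
  \<comment> \<open>The path from \<open>P\<^sub>0\<close> to \<open>Q\<^sub>0\<close> is trivial, and the descent to height \<open>0\<close> has weight \<open>0\<close>;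
    hence the separate value at the origin, the only domain point with \<open>a = b\<close>.\<close>
  define V where "V c j = (if fst c = snd c then if j = 0 \<and> fst c \<le> 0 then 1 else 0
      else if 0 < j \<and> fst c \<le> int j then path_count (nat (int j - fst c)) (nat (fst c - snd c - 1)) else 0)"
    for c :: "int \<times> int" and j :: nat
  let ?n = "Suc (Suc p)"
  have "det (mat ?n ?n (\<lambda>(i, j). V (0, - int i) j))
      = (\<Prod>i<?n. V (int i, 0) i) * (\<Sum>\<sigma>\<in>systems ?n (rotated_point \<circ> (\<lambda>i. (0, - int i))). coll_weight (-1) ?n \<sigma>)"
  proof (rule conjunct2[OF det_eq_sum_systems])
    fix a b :: int and j :: nat assume ab: "0 \<le> a" "b < 0"
    define y where "y = nat (a - b - 1)"
    have y: "nat (a - b - 1) = y" "nat (a + 1 - b - 1) = Suc y" "nat (a + 1 - (b + 1) - 1) = y"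
      "nat (a - (b + 1) - 1) = y - 1" "a - b + - 1 = int y" using ab by (auto simp: y_def)
    have V: "V (a, b) j = (if 0 < j \<and> a \<le> int j then path_count (nat (int j - a)) y else 0)"
      "V (a + 1, b) j = (if 0 < j \<and> a + 1 \<le> int j then path_count (nat (int j - (a + 1))) (Suc y) else 0)"
      "V (a + 1, b + 1) j = (if 0 < j \<and> a + 1 \<le> int j then path_count (nat (int j - (a + 1))) y else 0)"
      using ab by (simp_all only: V_def fst_conv snd_conv y) auto
    \<comment> \<open>The point \<open>(a, b + 1)\<close> is the origin exactly when
      \<open>y = 0\<close>, and then the factor \<open>y\<close> annihilates its separate
      value.\<close>
    have V': "[: int y :] * V (a, b + 1) j = [: int y :] * (if 0 < j \<and> a \<le> int j then path_count (nat (int j - a)) (y - 1) else 0)"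
    proof (cases "y = 0")
      case False
      then have "a \<noteq> b + 1" using ab by (auto simp: y_def)
      then show ?thesis by (simp only: V_def fst_conv snd_conv y) simp
    qed simp
    have "(if 0 < j \<and> a \<le> int j then path_count (nat (int j - a)) y else 0) =
        (if 0 < j \<and> a + 1 \<le> int j then path_count (nat (int j - (a + 1))) (Suc y) else 0) +
        RR * (if 0 < j \<and> a + 1 \<le> int j then path_count (nat (int j - (a + 1))) y else 0) +
        [: int y :] * (if 0 < j \<and> a \<le> int j then path_count (nat (int j - a)) (y - 1) else 0)"
    proof -
      consider "a > int j \<or> j = 0" | "a = int j" "0 < j" | "a < int j" "0 < j" by linarith
      then show ?thesis
      proof cases
        case 2
        then have "0 < y" using ab by (auto simp: y_def)
        then show ?thesis using 2 path_count_0_rec[of y] by simp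
      next
        case 3
        define k where "k = nat (int j - a - 1)"
        have k: "nat (int j - a) = Suc k" "nat (int j - (a + 1)) = k" using 3 by (auto simp: k_def)
        show ?thesis using 3 path_count_rec[of k y] unfolding k by simp
      qed auto
    qed
    then show "V (a, b) j = V (a + 1, b) j + RR * V (a + 1, b + 1) j + [:a - b + - 1:] * V (a, b + 1) j"
      unfolding y V V' .
  qed (auto simp: V_def)
  \<comment> \<open>Column 0 is a unit vector, nonzero only for the start at the origin; deleting it
    shifts both indices by one.\<close>
  moreover have "det (mat ?n ?n (\<lambda>(i, j). V (0, - int i) j)) = det (mat (Suc p) (Suc p) (\<lambda>(i, j). path_count (Suc j) i))"
    by (subst det_first_column_unit[where n = "Suc p"])
      (auto simp: V_def nat_add_distrib intro!: arg_cong[where f = det] eq_matI)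
  \<comment> \<open>The diagonal is 1 at the origin and \<open>(i - 1)!\<close> for \<open>i\<close>
    from 1 to \<open>p + 1\<close>.\<close>
  moreover have "(\<Prod>i<?n. V (int i, 0) i) = of_nat (sf p)"
  proof -
    have "(\<Prod>i<?n. V (int i, 0) i) = (\<Prod>i<Suc p. fact i)"
      unfolding prod.lessThan_Suc_shift[of _ "Suc p"]
      by (auto simp: V_def path_count_0 simp del: prod.lessThan_Suc intro!: prod.cong)
    also have "\<dots> = of_nat (sf p)"
      by (simp add: sf_def lessThan_Suc_atMost del: prod.lessThan_Suc)
    finally show ?thesis .
  qed
  ultimately show ?thesis by (simp add: rotated_point_column XX_eq_systems W2_def)
qed

theorem theorem6p1:
  fixes p :: nat
  shows "det (mat (p + 1) (p + 1) (\<lambda>(i, j). chi (i + j)))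
           = RR ^ p * of_nat (sf p) * (\<Sum>\<sigma>\<in>XX p. W0 p \<sigma>)
       \<and> det (mat (p + 1) (p + 1) (\<lambda>(i, j). chi (i + j + 2)))
           = RR ^ (p + 1) * of_nat (sf p) * (\<Sum>\<sigma>\<in>XX (p + 2). W2 (p + 2) \<sigma>)"
  using det_chi_shift_0[of p] det_chi_shift_2[of "Suc p"] det_path_count_systems_0[of p] det_path_count_systems_2[of p]
  by (simp only: Suc_eq_plus1 mult.assoc)

end
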